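(* Let $\mu,\nu\in\mathrm{M}_0(\mathbb{R}^d)$ and assume that for every $y\in\mathrm{spt}\,\nu\setminus\{0\}$ there exists $x\in\mathrm{spt}\,\mu$ such that $\langle x,y\rangle>0$. Let $\gamma\in\Gamma_{0,\mathrm{m}}(\mu,\nu)$. Then $\gamma$ is proper as soon as at least one of the two following properties holds: (i) for all $x\in\mathrm{spt}\,\mu$ and all $\delta>0$, $\mu\big(\mathrm{pos}(\mathbb{B}(x,\delta))\setminus\{0\}\big)=\infty$; (ii) there exists $\alpha>0$ such that for all $\lambda>0$, $\mu(\lambda\,\cdot\,)=\lambda^{-\alpha}\mu(\,\cdot\,)$.
   Context: $\mathrm{M}_0(\mathbb{R}^k)$ denotes the set of nonnegative Borel measures $\mu$ on $\mathbb{R}^k\setminus\{0\}$ such that $\mu(B)<\infty$ for every Borel set $B\subset\mathbb{R}^k\setminus\{0\}$ with $0\notin \mathrm{cl}(B)$ (closure in $\mathbb{R}^k$). The support $\mathrm{spt}\,\mu$ is the set of $x\in\mathbb{R}^k$ such that $\mu(U\setminus\{0\})>0$ for every open $U\subset\mathbb{R}^k$ containing $x$ (so $0$ may belong to $\mathrm{spt}\,\mu$). For $\mu,\nu\in\mathrm{M}_0(\mathbb{R}^d)$, a zero-coupling between $\mu$ and $\nu$ is a nonnegative Borel measure $\gamma$ on $(\mathbb{R}^d\times\mathbb{R}^d)\setminus\{(0,0)\}$ such that $\gamma(A\times\mathbb{R}^d)=\mu(A)$ and $\gamma(\mathbb{R}^d\times A)=\nu(A)$ for all Borel $A\subset\mathbb{R}^d\setminus\{0\}$;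 any such $\gamma$ belongs to $\mathrm{M}_0(\mathbb{R}^d\times\mathbb{R}^d)=\mathrm{M}_0(\mathbb{R}^{2d})$. $\Gamma_{0,\mathrm{m}}(\mu,\nu)$ is the set of zero-couplings whose support is monotone, i.e. $\langle x_1-x_2,y_1-y_2\rangle\ge0$ for all $(x_1,y_1),(x_2,y_2)\in\mathrm{spt}\,\gamma$. A zero-coupling $\gamma$ is proper if $\gamma(\{0\}\times(\mathbb{R}^d\setminus\{0\}))=0$. $\mathbb{B}(x,\delta)$ is the open Euclidean ball with center $x$ and radius $\delta$. For $C\subset\mathbb{R}^d$, $\mathrm{pos}(C)=\{\lambda x:x\in C,\lambda\ge0\}$. *)

theory Defs
  imports "HOL-Analysis.Analysis"
begin

abbreviation punctured_borel :: "'a::euclidean_space measure" where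
  "punctured_borel \<equiv> restrict_space borel (UNIV - {0})"

definition M0 :: "'a::euclidean_space measure set" where
  "M0 = {\<mu>. sets \<mu> = sets punctured_borel \<and>
             (\<forall>B \<in> sets punctured_borel. 0 \<notin> closure B \<longrightarrow> emeasure \<mu> B < \<infinity>)}"

text \<open>The origin is not in the space of the measure, but it may be in the support.\<close>

definition spt :: "'a::euclidean_space measure \<Rightarrow> 'a set" where
  "spt \<mu> = {x. \<forall>U. open U \<and> x \<in> U \<longrightarrow> emeasure \<mu> (U - {0}) > 0}"

text \<open>A zero-coupling lives on the product with only the point \<open>(0, 0)\<close> removed, which is
  \<open>0\<close> of the product type; it may thus charge the two punctured coordinate subspaces.\<close>

definition zero_couplings ::
    "'a::euclidean_space measure \<Rightarrow> 'a measure \<Rightarrow> ('a \<times> 'a) measure set" where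
  "zero_couplings \<mu> \<nu> = {\<gamma>. sets \<gamma> = sets punctured_borel \<and>
     (\<forall>A \<in> sets (punctured_borel :: 'a measure).
        emeasure \<gamma> (A \<times> UNIV) = emeasure \<mu> A \<and> emeasure \<gamma> (UNIV \<times> A) = emeasure \<nu> A)}"

definition monotone_set :: "('a::real_inner \<times> 'a) set \<Rightarrow> bool" where
  "monotone_set S \<longleftrightarrow>
     (\<forall>x1 y1 x2 y2. (x1, y1) \<in> S \<longrightarrow> (x2, y2) \<in> S \<longrightarrow> (x1 - x2) \<bullet> (y1 - y2) \<ge> 0)"

definition monotone_zero_couplings ::
    "'a::euclidean_space measure \<Rightarrow> 'a measure \<Rightarrow> ('a \<times> 'a) measure set" where
  "monotone_zero_couplings \<mu> \<nu> = {\<gamma> \<in> zero_couplings \<mu> \<nu>. monotone_set (spt \<gamma>)}"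

definition proper_coupling :: "('a::euclidean_space \<times> 'a) measure \<Rightarrow> bool" where
  "proper_coupling \<gamma> \<longleftrightarrow> emeasure \<gamma> ({0} \<times> (UNIV - {0})) = 0"

definition pos :: "'a::real_vector set \<Rightarrow> 'a set" where
  "pos C = {c *\<^sub>R x | c x. x \<in> C \<and> c \<ge> 0}"

end

theory Submission
  imports Defs
begin

text \<open>
  The argument plays the monotonicity of \<open>spt \<gamma>\<close> against an open cone on which \<open>\<mu>\<close> should have
  infinite mass. If \<open>\<gamma>\<close> is not proper, then, since \<open>\<gamma>\<close> is carried by its support, some point
  \<open>(0, y)\<close> with \<open>y \<noteq> 0\<close> lies in \<open>spt \<gamma>\<close>, and \<open>y \<in> spt \<nu>\<close>. Choose \<open>x \<in> spt \<mu>\<close> with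
  \<open>x \<bullet> y > 0\<close> and \<open>c > 0\<close> so small that \<open>x\<close> lies in the open cone
  \<open>K = {z. z \<bullet> y > c * norm z}\<close>.

  Monotonicity with respect to \<open>(0, y)\<close> says that every \<open>(a, b) \<in> spt \<gamma>\<close> satisfies
  \<open>a \<bullet> b \<ge> a \<bullet> y\<close>. If \<open>a \<in> K\<close>, the right-hand side exceeds \<open>c * norm a\<close>, which forces
  \<open>norm b \<ge> c\<close> (lemma \<open>monotone_set_norm_ge\<close>). Thus all the mass that \<open>\<gamma>\<close> takes from \<open>K\<close> is sent
  to points bounded away from the origin, where \<open>\<nu>\<close> is finite; hence \<open>\<mu> K < \<infinity>\<close>
  (lemma \<open>emeasure_open_cone_finite\<close>).

  Each of the two alternative hypotheses contradicts this. In the first one, \<open>K\<close> contains the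
  punctured cone over a small ball around \<open>x\<close>, which has infinite mass. In the second one,
  \<open>2 K = K\<close> and homogeneity leave only the values \<open>0\<close> and \<open>\<infinity>\<close> for \<open>\<mu> K\<close>, and \<open>0\<close> is excluded
  because \<open>K\<close> is an open neighbourhood of the support point \<open>x\<close>.
\<close>

lemma sets_punctured_borel_iff:
  "A \<in> sets (punctured_borel :: 'a::euclidean_space measure) \<longleftrightarrow> A \<in> sets borel \<and> 0 \<notin> A"
  by (subst sets_restrict_space_iff) auto

text \<open>
  The complement of the support is the union of the open sets that are null away from the
  origin. There may be uncountably many of them, but by Lindelof's theorem countably many have
  the same union.
\<close>

lemma null_sets_outside_spt:
  fixes \<mu> :: "'a::euclidean_space measure"
  assumes sets: "sets \<mu> = sets punctured_borel"
  shows "- spt \<mu> - {0} \<in> null_sets \<mu>"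
proof -
  define F where "F = {U. open U \<and> emeasure \<mu> (U - {0}) = 0}"
  obtain G where G: "G \<subseteq> F" "countable G" "\<Union>G = \<Union>F"
    using Lindelof[of F] by (auto simp: F_def)
  have "(\<Union>U\<in>G. U - {0}) \<in> null_sets \<mu>"
  proof (rule null_sets_UN'[OF G(2)])
    fix U assume "U \<in> G"
    then show "U - {0} \<in> null_sets \<mu>"
      using G(1) sets by (auto simp: F_def null_sets_def sets_punctured_borel_iff)
  qed
  moreover have "- spt \<mu> = \<Union>F"
    by (auto simp: spt_def F_def not_less)
  then have "- spt \<mu> - {0} = (\<Union>U\<in>G. U - {0})"
    using G(3) by auto
  ultimately show ?thesis by simp
qed

lemma spt_meets_if_positive:
  fixes \<mu> :: "'a::euclidean_space measure"
  assumes "sets \<mu> = sets punctured_borel" "emeasure \<mu> A \<noteq> 0"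
  obtains x where "x \<in> A" "x \<in> spt \<mu>"
proof -
  have A: "A \<in> sets \<mu>"
    using assms(2) emeasure_notin_sets by blast
  have "\<not> A \<subseteq> - spt \<mu> - {0}"
    using null_sets_subset[OF null_sets_outside_spt[OF assms(1)] A] assms(2) by auto
  moreover have "0 \<notin> A"
    using A assms(1) by (simp add: sets_punctured_borel_iff)
  ultimately show ?thesis using that by blast
qed

text \<open>
  This fails for \<open>y = 0\<close>, because the second marginal of \<open>\<gamma>\<close> is prescribed only away from \<open>0\<close>.
\<close>

lemma snd_spt_zero_coupling:
  assumes "\<gamma> \<in> zero_couplings \<mu> \<nu>" "(x, y) \<in> spt \<gamma>" "y \<noteq> 0"
  shows "y \<in> spt \<nu>"
  unfolding spt_def
proof safe
  fix V :: "'a set" assume V: "open V" "y \<in> V"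
  have "open (UNIV \<times> (V - {0}))" "(x, y) \<in> UNIV \<times> (V - {0})"
    using V assms(3) by (auto intro: open_Times open_delete)
  then have "emeasure \<gamma> (UNIV \<times> (V - {0}) - {0}) > 0"
    using assms(2) unfolding spt_def by blast
  also have "UNIV \<times> (V - {0}) - {0} = UNIV \<times> (V - {0})"
    by (auto simp: zero_prod_def)
  also have "emeasure \<gamma> (UNIV \<times> (V - {0})) = emeasure \<nu> (V - {0})"
    using assms(1) V by (simp add: zero_couplings_def sets_punctured_borel_iff)
  finally show "emeasure \<nu> (V - {0}) > 0" .
qed

text \<open>
  The points making an angle with \<open>y\<close> whose cosine exceeds \<open>c / norm y\<close>. The strict inequality
  makes the cone open and, at the same time, removes its apex.
\<close>

definition open_cone :: "'a::real_inner \<Rightarrow> real \<Rightarrow> 'a set" where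
  "open_cone y c = {z. z \<bullet> y > c * norm z}"

lemma open_open_cone: "open (open_cone y c)"
  unfolding open_cone_def by (intro open_Collect_less continuous_intros)

lemma zero_notin_open_cone: "0 \<notin> open_cone y c"
  by (simp add: open_cone_def)

lemma scaleR_mem_open_cone_iff:
  assumes "t > 0"
  shows "t *\<^sub>R z \<in> open_cone y c \<longleftrightarrow> z \<in> open_cone y c"
proof -
  have "t *\<^sub>R z \<in> open_cone y c \<longleftrightarrow> t * (c * norm z) < t * (z \<bullet> y)"
    using assms by (simp add: open_cone_def algebra_simps)
  also have "\<dots> \<longleftrightarrow> z \<in> open_cone y c"
    using assms by (simp add: open_cone_def)
  finally show ?thesis .
qed

lemma image_scaleR_open_cone:
  assumes "t > 0"
  shows "(\<lambda>z. t *\<^sub>R z) ` open_cone y c = open_cone y c"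
proof (intro equalityI subsetI)
  fix z assume "z \<in> open_cone y c"
  then have "z = t *\<^sub>R (z /\<^sub>R t)" "z /\<^sub>R t \<in> open_cone y c"
    using assms scaleR_mem_open_cone_iff[of "inverse t" z y c] by auto
  then show "z \<in> (\<lambda>z. t *\<^sub>R z) ` open_cone y c" by blast
qed (use assms scaleR_mem_open_cone_iff in auto)

lemma pos_subset_open_cone:
  assumes "C \<subseteq> open_cone y c"
  shows "pos C - {0} \<subseteq> open_cone y c"
proof
  fix z assume "z \<in> pos C - {0}"
  then obtain t x where "z = t *\<^sub>R x" "x \<in> C" "t > 0"
    unfolding pos_def by (auto simp: order_le_less)
  then show "z \<in> open_cone y c"
    using assms scaleR_mem_open_cone_iff by blast
qed

text \<open>
  The key use of monotonicity: comparison with \<open>(0, y)\<close> gives \<open>a \<bullet> b \<ge> a \<bullet> y > c * norm a\<close>, while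
  \<open>a \<bullet> b \<le> norm a * norm b\<close> by the Cauchy-Schwarz inequality. The bound does not depend on the
  size of \<open>a\<close>, so it holds even for points \<open>a\<close> arbitrarily close to the origin, where \<open>\<mu>\<close> may
  accumulate infinite mass.
\<close>

lemma monotone_set_norm_ge:
  assumes "monotone_set S" "(0, y) \<in> S" "(a, b) \<in> S" "a \<in> open_cone y c"
  shows "c \<le> norm b"
proof -
  have "(a - 0) \<bullet> (b - y) \<ge> 0"
    using assms(1-3) unfolding monotone_set_def by blast
  then have "c * norm a < a \<bullet> b"
    using assms(4) by (simp add: open_cone_def inner_diff_right)
  also have "a \<bullet> b \<le> norm b * norm a"
    using norm_cauchy_schwarz[of a b] by (simp add: mult.commute)
  finally show ?thesis
    by (meson mult_right_mono norm_ge_zero not_le order_less_imp_le)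
qed

text \<open>
  Up to a null set, \<open>\<gamma>\<close> restricted to \<open>K \<times> UNIV\<close> (with \<open>K\<close> the cone) lives on \<open>UNIV \<times> B\<close>, where \<open>B\<close> is
  the set of points at distance at least \<open>c\<close> from the origin. So \<open>\<mu> K \<le> \<nu> B\<close>, and \<open>\<nu> B\<close> is finite
  because \<open>\<nu> \<in> M0\<close>.
\<close>

lemma emeasure_open_cone_finite:
  fixes \<mu> \<nu> :: "'a::euclidean_space measure"
  assumes "\<nu> \<in> M0" "\<gamma> \<in> monotone_zero_couplings \<mu> \<nu>" "(0, y) \<in> spt \<gamma>" "c > 0"
  shows "emeasure \<mu> (open_cone y c) < \<infinity>"
proof -
  define B :: "'a set" where "B = {b. c \<le> norm b}"
  have zc: "\<gamma> \<in> zero_couplings \<mu> \<nu>" and mono: "monotone_set (spt \<gamma>)"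
    using assms(2) by (auto simp: monotone_zero_couplings_def)
  have sets: "sets \<gamma> = sets punctured_borel"
    using zc by (simp add: zero_couplings_def)
  have B: "closed B" "0 \<notin> B"
    using assms(4) unfolding B_def by (auto intro: closed_Collect_le continuous_intros)
  then have BM: "B \<in> sets punctured_borel"
    by (simp add: sets_punctured_borel_iff)
  have KM: "open_cone y c \<in> sets punctured_borel"
    by (simp add: sets_punctured_borel_iff open_open_cone zero_notin_open_cone)
  have UB: "UNIV \<times> B \<in> sets \<gamma>"
    using B unfolding sets sets_punctured_borel_iff
    by (auto simp: zero_prod_def intro!: borel_closed closed_Times)
  note null = null_sets_outside_spt[OF sets]
  have "open_cone y c \<times> UNIV \<subseteq> UNIV \<times> B \<union> (- spt \<gamma> - {0})"
    using monotone_set_norm_ge[OF mono assms(3)] zero_notin_open_cone[of y c]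
    by (auto simp: B_def zero_prod_def)
  then have "emeasure \<gamma> (open_cone y c \<times> UNIV) \<le> emeasure \<gamma> (UNIV \<times> B \<union> (- spt \<gamma> - {0}))"
    using UB null by (intro emeasure_mono) auto
  also have "\<dots> = emeasure \<gamma> (UNIV \<times> B)"
    by (rule emeasure_Un_null_set[OF UB null])
  also have "\<dots> = emeasure \<nu> B"
    using zc BM by (simp add: zero_couplings_def)
  also have "\<dots> < \<infinity>"
    using assms(1) BM B by (simp add: M0_def)
  finally show ?thesis
    using zc KM by (simp add: zero_couplings_def)
qed

lemma scaling_invariant_zero_or_infinite:
  fixes \<alpha> :: real
  assumes "\<alpha> > 0" "A \<in> sets \<mu>"
    and scale: "emeasure \<mu> ((\<lambda>x. 2 *\<^sub>R x) ` A) = ennreal (2 powr (- \<alpha>)) * emeasure \<mu> A"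
    and inv: "(\<lambda>x. 2 *\<^sub>R x) ` A = A"
  shows "emeasure \<mu> A = 0 \<or> emeasure \<mu> A = \<infinity>"
proof (cases "emeasure \<mu> A")
  case (real r)
  have "r = 2 powr (- \<alpha>) * r"
    using scale real unfolding inv by (simp flip: ennreal_mult)
  moreover have "2 powr (- \<alpha>) < 1"
    using assms(1) powr_less_mono[of "-\<alpha>" 0 2] by simp
  ultimately show ?thesis using real by auto
qed simp

theorem corollary3p6:
  fixes \<mu> \<nu> :: "'a::euclidean_space measure"
    and \<gamma> :: "('a \<times> 'a) measure"
  assumes "\<mu> \<in> M0" and "\<nu> \<in> M0"
    and "\<forall>y \<in> spt \<nu> - {0}. \<exists>x \<in> spt \<mu>. x \<bullet> y > 0"
    and "\<gamma> \<in> monotone_zero_couplings \<mu> \<nu>"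
    and "(\<forall>x \<in> spt \<mu>. \<forall>\<delta>>0. emeasure \<mu> (pos (ball x \<delta>) - {0}) = \<infinity>)
       \<or> (\<exists>\<alpha>::real. \<alpha> > 0 \<and> (\<forall>c::real. c > 0 \<longrightarrow>
            (\<forall>A \<in> sets \<mu>. emeasure \<mu> ((\<lambda>x. c *\<^sub>R x) ` A) = ennreal (c powr (- \<alpha>)) * emeasure \<mu> A)))"
  shows "proper_coupling \<gamma>"
proof (rule ccontr)
  assume "\<not> proper_coupling \<gamma>"
  then have pos_mass: "emeasure \<gamma> ({0} \<times> (UNIV - {0})) \<noteq> 0"
    by (simp add: proper_coupling_def)
  have zc: "\<gamma> \<in> zero_couplings \<mu> \<nu>"
    using assms(4) by (simp add: monotone_zero_couplings_def)
  have "sets \<gamma> = sets punctured_borel"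
    using zc by (simp add: zero_couplings_def)
  then obtain y where y: "(0, y) \<in> spt \<gamma>" "y \<noteq> 0"
    using spt_meets_if_positive[OF _ pos_mass] by auto
  obtain x where x: "x \<in> spt \<mu>" "x \<bullet> y > 0"
    using assms(3) snd_spt_zero_coupling[OF zc y] y(2) by blast
  \<comment> \<open>Half of the largest value for which \<open>x\<close> lies in the closed cone, so that \<open>x\<close> is interior.\<close>
  define c where "c = (x \<bullet> y) / (2 * norm x)"
  define K where "K = open_cone y c"
  have "x \<noteq> 0" using x(2) by auto
  then have c: "c > 0" and "x \<in> K"
    using x(2) by (auto simp: c_def K_def open_cone_def field_simps)
  have K: "open K" "0 \<notin> K"
    by (simp_all add: K_def open_open_cone zero_notin_open_cone)
  have KM: "K \<in> sets \<mu>"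
    using assms(1) K by (simp add: M0_def sets_punctured_borel_iff)
  have fin: "emeasure \<mu> K < \<infinity>"
    unfolding K_def by (rule emeasure_open_cone_finite[OF assms(2,4) y(1) c])
  from assms(5) show False
  proof (elim disjE exE conjE)
    assume inf: "\<forall>x \<in> spt \<mu>. \<forall>\<delta>>0. emeasure \<mu> (pos (ball x \<delta>) - {0}) = \<infinity>"
    obtain \<delta> where "\<delta> > 0" "ball x \<delta> \<subseteq> K"
      using K(1) \<open>x \<in> K\<close> openE by blast
    then have "emeasure \<mu> (pos (ball x \<delta>) - {0}) \<le> emeasure \<mu> K"
      using KM unfolding K_def by (intro emeasure_mono pos_subset_open_cone)
    then show False
      using inf fin x(1) \<open>\<delta> > 0\<close> by (simp add: top.extremum_unique)
  next
    fix \<alpha> :: real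
    assume "\<alpha> > 0" and hom: "\<forall>c::real. c > 0 \<longrightarrow>
      (\<forall>A \<in> sets \<mu>. emeasure \<mu> ((\<lambda>x. c *\<^sub>R x) ` A) = ennreal (c powr (- \<alpha>)) * emeasure \<mu> A)"
    have "emeasure \<mu> K = 0 \<or> emeasure \<mu> K = \<infinity>"
    proof (rule scaling_invariant_zero_or_infinite[OF \<open>\<alpha> > 0\<close> KM])
      show "emeasure \<mu> ((\<lambda>x. 2 *\<^sub>R x) ` K) = ennreal (2 powr (- \<alpha>)) * emeasure \<mu> K"
        using hom KM by simp
      show "(\<lambda>x. 2 *\<^sub>R x) ` K = K"
        unfolding K_def by (rule image_scaleR_open_cone) simp
    qed
    moreover have "emeasure \<mu> (K - {0}) > 0"
      using x(1) K(1) \<open>x \<in> K\<close> unfolding spt_def by blast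
    ultimately show False
      using fin K(2) by auto
  qed
qed

end
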